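(* Let $M=(m_{i,j})_{i,j=1}^{+\infty}$ be an infinite complex matrix of the form $$M=\begin{pmatrix}\omega_1 & \alpha_1^{(1)} & \alpha_1^{(2)} & \cdots\\ 0 & \omega_2 & \alpha_2^{(1)} & \alpha_2^{(2)}\\ 0 & & \ddots & \\ \vdots & & & \end{pmatrix},$$ that is, $m_{i,i}=\omega_i$ for $i\ge 1$, $m_{i,i+j}=\alpha_i^{(j)}\in\mathbb{C}$ for $i,j\ge 1$, and $m_{i,j}=0$ for $i>j$, with - $\omega_i\in\mathbb{D}$ for all $i\ge 1$; - $\alpha_i^{(1)}=\sqrt{1-|\omega_i|^2}\,\sqrt{1-|\omega_{i+1}|^2}$ for all $i\ge 1$. Then $M$ defines a contraction on $\ell^2(\mathbb{N})$ if and only if $$\alpha_i^{(j)}=\left(\prod_{k=i+1}^{i+j-1}(-\overline{\omega_k})\right)\sqrt{1-|\omega_i|^2}\,\sqrt{1-|\omega_{i+j}|^2}\quad\text{for all } i,j\ge 1.$$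
   Context: $\mathbb{D}$ is the open unit disk in $\mathbb{C}$. $\ell^2(\mathbb{N})$ is the complex Hilbert space of square-summable sequences, with canonical orthonormal basis $(e_n)_{n\ge1}$ (indexed from $1$). An infinite matrix $M=(m_{i,j})_{i,j\ge1}$ defines a contraction on $\ell^2(\mathbb{N})$ if there is a bounded linear operator $T$ on $\ell^2(\mathbb{N})$ with operator norm $\|T\|\le 1$ whose matrix with respect to the canonical basis is $M$, i.e. $\langle Te_j,e_i\rangle=m_{i,j}$ for all $i,j\ge1$. An empty product equals $1$. *)

theory Defs
  imports "HOL-Analysis.Analysis"
begin

text \<open>
  Complex sequences $(x_n)_{n \ge 1}$ are functions on \<^typ>\<open>nat\<close> whose (meaningless) entry at
  index 0 is fixed to be 0, so that coordinates, basis vectors and matrix entries keep their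
  indices starting from 1.
\<close>

typedef ell2 = "{x :: nat \<Rightarrow> complex. x 0 = 0 \<and> summable (\<lambda>n. (cmod (x n))\<^sup>2)}"
  morphisms coord Abs_ell2
  by (rule exI[of _ "\<lambda>_. 0"]) simp

setup_lifting type_definition_ell2

lemma ell2_summable_mult:
  fixes x y :: "nat \<Rightarrow> complex"
  assumes "summable (\<lambda>n. (cmod (x n))\<^sup>2)" "summable (\<lambda>n. (cmod (y n))\<^sup>2)"
  shows "summable (\<lambda>n. x n * cnj (y n))"
proof (rule summable_comparison_test')
  show "summable (\<lambda>n. (cmod (x n))\<^sup>2 + (cmod (y n))\<^sup>2)"
    using assms by (rule summable_add)
  fix n
  have "2 * (cmod (x n) * cmod (y n)) \<le> (cmod (x n))\<^sup>2 + (cmod (y n))\<^sup>2"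
    using sum_squares_bound[of "cmod (x n)" "cmod (y n)"] by (simp add: mult.assoc)
  moreover have "0 \<le> cmod (x n) * cmod (y n)" by simp
  ultimately show "norm (x n * cnj (y n)) \<le> (cmod (x n))\<^sup>2 + (cmod (y n))\<^sup>2"
    unfolding norm_mult complex_mod_cnj by linarith
qed

lemma ell2_summable_add:
  fixes x y :: "nat \<Rightarrow> complex"
  assumes "summable (\<lambda>n. (cmod (x n))\<^sup>2)" "summable (\<lambda>n. (cmod (y n))\<^sup>2)"
  shows "summable (\<lambda>n. (cmod (x n + y n))\<^sup>2)"
proof (rule summable_comparison_test')
  show "summable (\<lambda>n. 2 * ((cmod (x n))\<^sup>2 + (cmod (y n))\<^sup>2))"
    using assms by (intro summable_mult summable_add)
  fix n
  have "(cmod (x n + y n))\<^sup>2 \<le> (cmod (x n) + cmod (y n))\<^sup>2"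
    by (intro power_mono norm_triangle_ineq norm_ge_zero)
  also have "\<dots> \<le> 2 * ((cmod (x n))\<^sup>2 + (cmod (y n))\<^sup>2)"
    using sum_squares_bound[of "cmod (x n)" "cmod (y n)"] by (simp add: power2_sum)
  finally show "norm ((cmod (x n + y n))\<^sup>2) \<le> 2 * ((cmod (x n))\<^sup>2 + (cmod (y n))\<^sup>2)"
    by simp
qed

lift_definition scaleC :: "complex \<Rightarrow> ell2 \<Rightarrow> ell2"  (infixr \<open>*\<^sub>C\<close> 75)
  is "\<lambda>c x n. c * x n"
  by (simp add: norm_mult power_mult_distrib summable_mult)

lift_definition cinner :: "ell2 \<Rightarrow> ell2 \<Rightarrow> complex"
  is "\<lambda>x y. \<Sum>n. x n * cnj (y n)" .

instantiation ell2 :: real_vector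
begin
lift_definition zero_ell2 :: ell2 is "\<lambda>_. 0" by simp
lift_definition plus_ell2 :: "ell2 \<Rightarrow> ell2 \<Rightarrow> ell2" is "\<lambda>x y n. x n + y n"
  by (simp add: ell2_summable_add)
lift_definition uminus_ell2 :: "ell2 \<Rightarrow> ell2" is "\<lambda>x n. - x n" by simp
lift_definition minus_ell2 :: "ell2 \<Rightarrow> ell2 \<Rightarrow> ell2" is "\<lambda>x y n. x n - y n"
  using ell2_summable_add[where y = "\<lambda>n. - y n" for y] by simp
lift_definition scaleR_ell2 :: "real \<Rightarrow> ell2 \<Rightarrow> ell2" is "\<lambda>r x n. r *\<^sub>R x n"
  by (simp add: power_mult_distrib summable_mult)
instance
  by standard (transfer; simp add: fun_eq_iff algebra_simps)+
end

instantiation ell2 :: real_inner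
begin
lift_definition norm_ell2 :: "ell2 \<Rightarrow> real" is "\<lambda>x. sqrt (\<Sum>n. (cmod (x n))\<^sup>2)" .
definition inner_ell2 :: "ell2 \<Rightarrow> ell2 \<Rightarrow> real" where "inner_ell2 x y = Re (cinner x y)"
definition dist_ell2 :: "ell2 \<Rightarrow> ell2 \<Rightarrow> real" where "dist_ell2 x y = norm (x - y)"
definition sgn_ell2 :: "ell2 \<Rightarrow> ell2" where "sgn_ell2 x = inverse (norm x) *\<^sub>R x"
definition uniformity_ell2 :: "(ell2 \<times> ell2) filter" where
  "uniformity_ell2 = (INF e\<in>{0 <..}. principal {(x, y). dist x y < e})"
definition open_ell2 :: "ell2 set \<Rightarrow> bool" where
  "open_ell2 U = (\<forall>x\<in>U. \<forall>\<^sub>F (x', y) in uniformity. x' = x \<longrightarrow> y \<in> U)"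

instance
proof
  have sq: "inner x x = (\<Sum>n. (cmod (coord x n))\<^sup>2)"
    and sm: "summable (\<lambda>n. (cmod (coord x n))\<^sup>2)" for x :: ell2
  proof -
    show s: "summable (\<lambda>n. (cmod (coord x n))\<^sup>2)"
      using coord[of x] by simp
    have "cinner x x = (\<Sum>n. complex_of_real ((cmod (coord x n))\<^sup>2))"
      by (simp add: cinner.rep_eq complex_norm_square del: of_real_power)
    also have "\<dots> = of_real (\<Sum>n. (cmod (coord x n))\<^sup>2)"
      using s by (rule suminf_of_real[symmetric])
    finally show "inner x x = (\<Sum>n. (cmod (coord x n))\<^sup>2)"
      by (simp add: inner_ell2_def)
  qed
  have ms: "summable (\<lambda>n. coord x n * cnj (coord y n))" for x y
    using coord[of x] coord[of y] by (intro ell2_summable_mult) auto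
  fix x y z :: ell2 and r :: real and U :: "ell2 set"
  show "dist x y = norm (x - y)" by (rule dist_ell2_def)
  show "sgn x = inverse (norm x) *\<^sub>R x" by (rule sgn_ell2_def)
  show "uniformity = (INF e\<in>{0 <..}. principal {(x :: ell2, y). dist x y < e})"
    by (rule uniformity_ell2_def)
  show "open U = (\<forall>x\<in>U. \<forall>\<^sub>F (x', y) in uniformity. x' = x \<longrightarrow> y \<in> U)"
    by (rule open_ell2_def)
  have "cinner x y = cnj (cinner y x)"
    using bounded_linear.suminf[OF bounded_linear_cnj ms[of y x]] by (simp add: cinner.rep_eq mult.commute)
  then show "inner x y = inner y x" by (simp add: inner_ell2_def)
  show "inner (x + y) z = inner x z + inner y z"
    using suminf_add[OF ms[of x z] ms[of y z], symmetric]
    by (simp add: inner_ell2_def cinner.rep_eq plus_ell2.rep_eq distrib_right)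
  show "inner (r *\<^sub>R x) y = r * inner x y"
    using suminf_mult[OF ms[of x y], of "of_real r"]
    by (simp add: inner_ell2_def cinner.rep_eq scaleR_ell2.rep_eq scaleR_conv_of_real mult.assoc)
  show "0 \<le> inner x x"
    unfolding sq by (intro suminf_nonneg sm) simp
  show "inner x x = 0 \<longleftrightarrow> x = 0"
    unfolding sq by (subst suminf_eq_zero_iff[OF sm])
      (auto simp: coord_inject[symmetric] zero_ell2.rep_eq fun_eq_iff)
  show "norm x = sqrt (inner x x)"
    by (simp add: sq norm_ell2.rep_eq)
qed
end

text \<open>The basis vector $e_n$, for $n \ge 1$; index 0 gives the zero vector and is never used.\<close>

lift_definition ell2_basis :: "nat \<Rightarrow> ell2"
  is "\<lambda>n k. if k = n \<and> n \<ge> 1 then 1 else 0"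
proof (intro conjI)
  fix n :: nat
  show "summable (\<lambda>k. (cmod (if k = n \<and> n \<ge> 1 then 1 else 0))\<^sup>2)"
    by (rule summable_finite[of "{n}"]) auto
qed auto

definition bounded_operator :: "(ell2 \<Rightarrow> ell2) \<Rightarrow> bool" where
  "bounded_operator T \<longleftrightarrow> bounded_linear T \<and> (\<forall>c x. T (c *\<^sub>C x) = c *\<^sub>C T x)"

definition defines_contraction :: "(nat \<Rightarrow> nat \<Rightarrow> complex) \<Rightarrow> bool" where
  "defines_contraction M \<longleftrightarrow>
    (\<exists>T. bounded_operator T \<and> onorm T \<le> 1 \<and>
      (\<forall>i\<ge>1. \<forall>j\<ge>1. cinner (T (ell2_basis j)) (ell2_basis i) = M i j))"

end

theory Submission
  imports Defs
begin

text \<open>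
  A matrix defines a contraction iff all its finite truncations do. Put
  $d_i = \sqrt{1-|\omega_i|^2}$. If the entries have the stated form, the $i$-th coordinate of $Mx$
  is $\omega_i x_i + d_i s_i$, where $s_{i-1} = d_i x_i - \overline{\omega_i} s_i$ and $s_i = 0$ beyond
  the support of the finitely supported $x$. As the matrix
  with rows $(\omega_i, d_i)$ and $(d_i, -\overline{\omega_i})$ is unitary,
  $|(Mx)_i|^2 + |s_{i-1}|^2 = |x_i|^2 + |s_i|^2$, which telescopes to contractivity.

  Conversely, proceed by induction on the distance $j$ from the diagonal. The vector
  $x = e_{i+j} + t e_{i+1}$ with $t$ chosen such that $s_i = 0$ is mapped isometrically by the
  rows $i+1, \dots, i+j$, whose entries are already known, so contractivity forces
  $(Mx)_i = d_i d_{i+1} t + \alpha_i^{(j)} = 0$.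
\<close>

section \<open>Coordinates and finite combinations of basis vectors\<close>

lemma coord_0 [simp]: "coord x 0 = 0"
  and summable_coord: "summable (\<lambda>n. (cmod (coord x n))\<^sup>2)"
  using coord[of x] by auto

lemma coord_Abs_ell2:
  assumes "x 0 = 0" "summable (\<lambda>n. (cmod (x n))\<^sup>2)"
  shows "coord (Abs_ell2 x) = x"
  using assms by (simp add: Abs_ell2_inverse)

lemma norm_ell2_sq: "(norm x)\<^sup>2 = (\<Sum>n. (cmod (coord x n))\<^sup>2)"
  by (simp add: norm_ell2.rep_eq suminf_nonneg summable_coord)

lemma sum_coord_le_norm_sq:
  assumes "finite A"
  shows "(\<Sum>n\<in>A. (cmod (coord x n))\<^sup>2) \<le> (norm x)\<^sup>2"
  unfolding norm_ell2_sq by (rule sum_le_suminf[OF summable_coord assms]) simp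

lemma cinner_ell2_basis:
  assumes "i \<ge> 1"
  shows "cinner x (ell2_basis i) = coord x i"
proof -
  have "(\<lambda>n. coord x n * cnj (coord (ell2_basis i) n)) = (\<lambda>n. if n = i then coord x n else 0)"
    using assms by (auto simp: ell2_basis.rep_eq fun_eq_iff)
  then show ?thesis
    using sums_single[of i "coord x"] by (simp add: cinner.rep_eq sums_iff)
qed

lemma coord_sum: "coord (\<Sum>a\<in>A. f a) n = (\<Sum>a\<in>A. coord (f a) n)"
  by (induction A rule: infinite_finite_induct) (auto simp: zero_ell2.rep_eq plus_ell2.rep_eq)

lemma coord_basis_combination:
  "coord (\<Sum>j = 1..N. x j *\<^sub>C ell2_basis j) n = (if n \<in> {1..N} then x n else 0)"
proof -
  have "coord (\<Sum>j = 1..N. x j *\<^sub>C ell2_basis j) n = (\<Sum>j = 1..N. if n = j then x j else 0)"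
    unfolding coord_sum by (intro sum.cong) (auto simp: scaleC.rep_eq ell2_basis.rep_eq)
  then show ?thesis by simp
qed

section \<open>Contractivity through finite truncations\<close>

definition truncations_contractive :: "(nat \<Rightarrow> nat \<Rightarrow> complex) \<Rightarrow> bool" where
  "truncations_contractive M \<longleftrightarrow>
    (\<forall>N x. (\<Sum>i = 1..N. (cmod (\<Sum>j = 1..N. M i j * x j))\<^sup>2) \<le> (\<Sum>j = 1..N. (cmod (x j))\<^sup>2))"

lemma defines_contraction_imp_truncations:
  assumes "defines_contraction M"
  shows "truncations_contractive M"
  unfolding truncations_contractive_def
proof (intro allI)
  fix N :: nat and x :: "nat \<Rightarrow> complex"
  obtain T where T: "bounded_linear T" "\<And>c x. T (c *\<^sub>C x) = c *\<^sub>C T x" "onorm T \<le> 1"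
    and TM: "\<And>i j. i \<ge> 1 \<Longrightarrow> j \<ge> 1 \<Longrightarrow> cinner (T (ell2_basis j)) (ell2_basis i) = M i j"
    using assms unfolding defines_contraction_def bounded_operator_def by blast
  define v where "v = (\<Sum>j = 1..N. x j *\<^sub>C ell2_basis j)"
  have Tv: "coord (T v) i = (\<Sum>j = 1..N. M i j * x j)" if "i \<in> {1..N}" for i
  proof -
    have "T v = (\<Sum>j = 1..N. x j *\<^sub>C T (ell2_basis j))"
      unfolding v_def using T(2) by (simp add: bounded_linear.linear[OF T(1)] linear_sum)
    then show ?thesis
      using that TM
      by (auto simp: coord_sum scaleC.rep_eq cinner_ell2_basis mult.commute intro!: sum.cong)
  qed
  have "norm (T v) \<le> norm v"
    using onorm[OF T(1), of v] mult_right_mono[OF T(3), of "norm v"] by simp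
  then have "(norm (T v))\<^sup>2 \<le> (norm v)\<^sup>2"
    by (simp add: power_mono)
  moreover have "(\<Sum>i = 1..N. (cmod (\<Sum>j = 1..N. M i j * x j))\<^sup>2) \<le> (norm (T v))\<^sup>2"
    using sum_coord_le_norm_sq[of "{1..N}" "T v"] by (simp add: Tv)
  moreover have "(norm v)\<^sup>2 = (\<Sum>j = 1..N. (cmod (x j))\<^sup>2)"
    unfolding norm_ell2_sq v_def coord_basis_combination
    by (subst suminf_finite[of "{1..N}"]) auto
  ultimately show "(\<Sum>i = 1..N. (cmod (\<Sum>j = 1..N. M i j * x j))\<^sup>2) \<le> (\<Sum>j = 1..N. (cmod (x j))\<^sup>2)"
    by linarith
qed

text \<open>Let \<open>S\<close> be a partial sum of the squared moduli of row \<open>i\<close>.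
  Testing a truncation on the conjugate of that row gives \<open>S\<close> as coordinate
  \<open>i\<close> of the image, so \<open>S^2\<close> is at most \<open>S\<close>. Square summable
  rows make the series for \<open>Mx\<close> converge for every \<open>x\<close> in
  \<open>ell2\<close>.\<close>

lemma truncations_contractive_summable_row:
  assumes "truncations_contractive M" "i \<ge> 1"
  shows "summable (\<lambda>k. (cmod (M i k))\<^sup>2)"
proof -
  have "(\<Sum>k<n. (cmod (M i (Suc k)))\<^sup>2) \<le> 1" for n
  proof -
    \<comment> \<open>The truncation must contain both row \<open>i\<close> and the first
      \<open>n\<close> columns.\<close>
    define N where "N = max n i"
    define S where "S = (\<Sum>j = 1..N. (cmod (M i j))\<^sup>2)"
    have S0: "0 \<le> S" unfolding S_def by (simp add: sum_nonneg)
    have row: "(\<Sum>j = 1..N. M i j * cnj (M i j)) = of_real S"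
      unfolding S_def of_real_sum by (intro sum.cong refl) (metis complex_norm_square of_real_power)
    have "S\<^sup>2 = (cmod (\<Sum>j = 1..N. M i j * cnj (M i j)))\<^sup>2"
      unfolding row by simp
    also have "\<dots> \<le> (\<Sum>i' = 1..N. (cmod (\<Sum>j = 1..N. M i' j * cnj (M i j)))\<^sup>2)"
      using assms(2) by (intro member_le_sum) (auto simp: N_def)
    also have "\<dots> \<le> S"
      using assms(1)[unfolded truncations_contractive_def, rule_format, where N = N and x = "\<lambda>j. cnj (M i j)"]
      by (simp add: S_def)
    finally have "S \<le> 1"
      using S0 by (metis mult.right_neutral mult_le_cancel_left_pos order_le_less power2_eq_square zero_le_one)
    moreover have "(\<Sum>k<n. (cmod (M i (Suc k)))\<^sup>2) = (\<Sum>j = 1..n. (cmod (M i j))\<^sup>2)"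
      by (simp add: sum.atLeast1_atMost_eq)
    moreover have "\<dots> \<le> S"
      unfolding S_def N_def by (intro sum_mono2) auto
    ultimately show ?thesis by linarith
  qed
  then have "summable (\<lambda>k. (cmod (M i (Suc k)))\<^sup>2)"
    by (intro summableI_nonneg_bounded) auto
  then show ?thesis by (rule summable_Suc_iff[THEN iffD1])
qed

lemma truncations_imp_defines_contraction:
  assumes contr: "truncations_contractive M"
  shows "defines_contraction M"
proof -
  \<comment> \<open>The value 0 at index 0 is forced by the type \<open>ell2\<close>; row 0 of
    \<open>M\<close> is arbitrary.\<close>
  define t where "t x i = (if i = 0 then 0 else \<Sum>k. M i k * coord x k)" for x i
  define T where "T x = Abs_ell2 (t x)" for x
  have summ: "summable (\<lambda>k. M i k * coord x k)" if "i \<ge> 1" for i x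
    using ell2_summable_mult[OF truncations_contractive_summable_row[OF contr that], of "\<lambda>k. cnj (coord x k)"]
    by (simp add: summable_coord)
  \<comment> \<open>Two limits in turn: here \<open>n\<close> rows stay fixed while the number
    \<open>N\<close> of columns grows, and for \<open>N >= n\<close> the block is dominated by the
    truncation of size \<open>N\<close>. Letting \<open>n\<close> grow afterwards bounds the norm of
    \<open>T x\<close>.\<close>
  have partial: "(\<Sum>i = 1..n. (cmod (t x i))\<^sup>2) \<le> (norm x)\<^sup>2" for n x
  proof (rule LIMSEQ_le_const2)
    have "(\<lambda>N. \<Sum>k = 1..N. M i k * coord x k) \<longlonglongrightarrow> t x i" if "i \<ge> 1" for i
    proof -
      have "(\<lambda>N. \<Sum>k<Suc N. M i k * coord x k) \<longlonglongrightarrow> t x i"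
        using LIMSEQ_Suc[OF summable_LIMSEQ[OF summ[OF that, of x]]] that by (simp add: t_def del: sum.lessThan_Suc)
      moreover have "(\<Sum>k<Suc N. M i k * coord x k) = (\<Sum>k = 1..N. M i k * coord x k)" for N
        by (subst sum.lessThan_Suc_shift) (simp add: sum.atLeast1_atMost_eq)
      ultimately show ?thesis by simp
    qed
    then show "(\<lambda>N. \<Sum>i = 1..n. (cmod (\<Sum>k = 1..N. M i k * coord x k))\<^sup>2) \<longlonglongrightarrow> (\<Sum>i = 1..n. (cmod (t x i))\<^sup>2)"
      by (intro tendsto_intros) auto
    have "(\<Sum>i = 1..n. (cmod (\<Sum>k = 1..N. M i k * coord x k))\<^sup>2) \<le> (norm x)\<^sup>2" if "N \<ge> n" for N
    proof -
      have "(\<Sum>i = 1..n. (cmod (\<Sum>k = 1..N. M i k * coord x k))\<^sup>2)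
          \<le> (\<Sum>i = 1..N. (cmod (\<Sum>k = 1..N. M i k * coord x k))\<^sup>2)"
        using that by (intro sum_mono2) auto
      also have "\<dots> \<le> (\<Sum>k = 1..N. (cmod (coord x k))\<^sup>2)"
        using contr unfolding truncations_contractive_def by blast
      also have "\<dots> \<le> (norm x)\<^sup>2"
        by (rule sum_coord_le_norm_sq) simp
      finally show ?thesis .
    qed
    then show "\<exists>N0. \<forall>N\<ge>N0. (\<Sum>i = 1..n. (cmod (\<Sum>k = 1..N. M i k * coord x k))\<^sup>2) \<le> (norm x)\<^sup>2"
      by blast
  qed
  have partial': "(\<Sum>i<n. (cmod (t x i))\<^sup>2) \<le> (norm x)\<^sup>2" for n x
  proof -
    have "(\<Sum>i<n. (cmod (t x i))\<^sup>2) \<le> (\<Sum>i<Suc n. (cmod (t x i))\<^sup>2)" by simp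
    also have "\<dots> = (\<Sum>i = 1..n. (cmod (t x i))\<^sup>2)"
      by (subst sum.lessThan_Suc_shift) (simp add: sum.atLeast1_atMost_eq t_def)
    finally show ?thesis using partial[where n = n and x = x] by linarith
  qed
  have summ_t: "summable (\<lambda>i. (cmod (t x i))\<^sup>2)" for x
    by (rule summableI_nonneg_bounded[OF _ partial']) simp
  have coordT: "coord (T x) = t x" for x
    unfolding T_def by (rule coord_Abs_ell2[OF _ summ_t]) (simp add: t_def)
  have normT: "norm (T x) \<le> norm x" for x
  proof (rule power2_le_imp_le)
    show "(norm (T x))\<^sup>2 \<le> (norm x)\<^sup>2"
      unfolding norm_ell2_sq[of "T x"] coordT by (rule suminf_le_const[OF summ_t partial'])
  qed simp
  have add: "T (x + y) = T x + T y" for x y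
    unfolding coord_inject[symmetric]
    by (auto simp: fun_eq_iff coordT plus_ell2.rep_eq t_def distrib_left suminf_add[symmetric] summ)
  have scaleC: "T (c *\<^sub>C x) = c *\<^sub>C T x" for c x
    unfolding coord_inject[symmetric]
    by (auto simp: fun_eq_iff coordT scaleC.rep_eq t_def mult.left_commute suminf_mult summ)
  have scaleR_scaleC: "r *\<^sub>R x = of_real r *\<^sub>C x" for r and x :: ell2
    unfolding coord_inject[symmetric]
    by (simp add: fun_eq_iff scaleR_ell2.rep_eq scaleC.rep_eq scaleR_conv_of_real)
  have "bounded_linear T"
    by (rule bounded_linear_intro[where K = 1]) (auto simp: add scaleC scaleR_scaleC normT)
  moreover have "onorm T \<le> 1"
    by (rule onorm_bound) (auto simp: normT)
  moreover have "cinner (T (ell2_basis j)) (ell2_basis i) = M i j" if "i \<ge> 1" "j \<ge> 1" for i j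
  proof -
    have "(\<lambda>k. M i k * coord (ell2_basis j) k) = (\<lambda>k. if k = j then M i k else 0)"
      using that by (auto simp: ell2_basis.rep_eq fun_eq_iff)
    then show ?thesis
      using that sums_single[of j "M i"] by (simp add: cinner_ell2_basis coordT t_def sums_iff)
  qed
  ultimately show ?thesis
    unfolding defines_contraction_def bounded_operator_def using scaleC by blast
qed

lemma defines_contraction_iff_truncations: "defines_contraction M \<longleftrightarrow> truncations_contractive M"
  using defines_contraction_imp_truncations truncations_imp_defines_contraction by blast

section \<open>Unitary rotations and the energy identity\<close>

definition defect :: "complex \<Rightarrow> real" where
  "defect w = sqrt (1 - (cmod w)\<^sup>2)"

lemma defect_sq: "cmod w < 1 \<Longrightarrow> (defect w)\<^sup>2 = 1 - (cmod w)\<^sup>2"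
  by (simp add: defect_def power_le_one)

lemma defect_pos: "cmod w < 1 \<Longrightarrow> 0 < defect w"
  by (simp add: defect_def power_less_one_iff)

lemma rotation_preserves_energy:
  fixes w x s :: complex
  assumes "cmod w < 1"
  shows "(cmod (w * x + defect w * s))\<^sup>2 + (cmod (defect w * x - cnj w * s))\<^sup>2
    = (cmod x)\<^sup>2 + (cmod s)\<^sup>2"
proof -
  \<comment> \<open>The cross terms cancel because \<open>defect w\<close> is real; the relation
    between \<open>w\<close> and its defect enters only through the common factor.\<close>
  have "(cmod (w * x + defect w * s))\<^sup>2 + (cmod (defect w * x - cnj w * s))\<^sup>2
    = ((cmod w)\<^sup>2 + (defect w)\<^sup>2) * ((cmod x)\<^sup>2 + (cmod s)\<^sup>2)"
    unfolding cmod_power2 by (simp add: algebra_simps power2_eq_square)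
  then show ?thesis using defect_sq[OF assms] by simp
qed

text \<open>In the notation of the overview, this is the coefficient of \<open>x j\<close> in the
  state \<open>s_i\<close>, for \<open>i < j\<close>.\<close>

definition transfer :: "(nat \<Rightarrow> complex) \<Rightarrow> nat \<Rightarrow> nat \<Rightarrow> complex" where
  "transfer \<omega> i j = (\<Prod>k = i + 1..<j. - cnj (\<omega> k)) * defect (\<omega> j)"

lemma transfer_Suc_same: "transfer \<omega> i (Suc i) = defect (\<omega> (Suc i))"
  by (simp add: transfer_def)

lemma transfer_step:
  assumes "Suc i < j"
  shows "transfer \<omega> i j = - cnj (\<omega> (Suc i)) * transfer \<omega> (Suc i) j"
  using assms by (simp add: transfer_def prod.atLeast_Suc_lessThan)

text \<open>Downward induction on \<open>a\<close> from \<open>N\<close>, where all sums are empty.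
  Each step adds row and column \<open>a + 1\<close> and one rotation, with \<open>x (a + 1)\<close>
  and the state \<open>s_{a+1}\<close> as input. The entries of \<open>M\<close> are prescribed only
  inside the window from \<open>a + 1\<close> to \<open>N\<close>, so that the identity applies
  while other entries are still unknown.\<close>

lemma energy_identity:
  assumes disk: "\<And>i. i \<ge> 1 \<Longrightarrow> cmod (\<omega> i) < 1"
    and diag: "\<And>i. a < i \<Longrightarrow> i \<le> N \<Longrightarrow> M i i = \<omega> i"
    and lower: "\<And>i j. a < j \<Longrightarrow> j < i \<Longrightarrow> i \<le> N \<Longrightarrow> M i j = 0"
    and upper: "\<And>i j. a < i \<Longrightarrow> i < j \<Longrightarrow> j \<le> N \<Longrightarrow> M i j = defect (\<omega> i) * transfer \<omega> i j"
    and "a \<le> N"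
  shows "(\<Sum>i = a + 1..N. (cmod (\<Sum>j = a + 1..N. M i j * x j))\<^sup>2)
      + (cmod (\<Sum>j = a + 1..N. transfer \<omega> a j * x j))\<^sup>2 = (\<Sum>j = a + 1..N. (cmod (x j))\<^sup>2)"
  using \<open>a \<le> N\<close> diag lower upper
proof (induction rule: inc_induct)
  case base
  then show ?case by simp
next
  case (step a)
  let ?w = "\<omega> (Suc a)" and ?x = "x (Suc a)"
  let ?s = "\<Sum>j = Suc (Suc a)..N. transfer \<omega> (Suc a) j * x j"
  have split: "(\<Sum>j = Suc a..N. f j) = f (Suc a) + (\<Sum>j = Suc (Suc a)..N. f j)"
    for f :: "nat \<Rightarrow> 'b :: comm_monoid_add"
    using step.hyps by (simp add: sum.atLeast_Suc_atMost)
  have IH: "(\<Sum>i = Suc (Suc a)..N. (cmod (\<Sum>j = Suc (Suc a)..N. M i j * x j))\<^sup>2) + (cmod ?s)\<^sup>2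
      = (\<Sum>j = Suc (Suc a)..N. (cmod (x j))\<^sup>2)"
    using step.IH step.prems by simp
  \<comment> \<open>Column \<open>a + 1\<close> vanishes below the diagonal.\<close>
  have rest: "(\<Sum>i = Suc (Suc a)..N. (cmod (\<Sum>j = Suc a..N. M i j * x j))\<^sup>2)
      = (\<Sum>i = Suc (Suc a)..N. (cmod (\<Sum>j = Suc (Suc a)..N. M i j * x j))\<^sup>2)"
    unfolding split[of "\<lambda>j. M _ j * x j"] using step.prems(2) by (intro sum.cong) auto
  have row: "(\<Sum>j = Suc a..N. M (Suc a) j * x j) = ?w * ?x + defect ?w * ?s"
    unfolding split sum_distrib_left using step.prems(1,3) step.hyps
    by (intro arg_cong2[where f = "(+)"] sum.cong) (auto simp: mult.assoc)
  \<comment> \<open>By \<open>transfer_step\<close>, each later coefficient of the state carries the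
    same factor \<open>- cnj ?w\<close>.\<close>
  have state: "(\<Sum>j = Suc a..N. transfer \<omega> a j * x j) = defect ?w * ?x - cnj ?w * ?s"
    unfolding split
    by (simp add: transfer_Suc_same transfer_step sum_distrib_left mult.assoc sum_negf)
  show ?case
    using rotation_preserves_energy[OF disk, of "Suc a" ?x ?s] IH
    unfolding Suc_eq_plus1[symmetric] split[of "\<lambda>i. (cmod (\<Sum>j = Suc a..N. M i j * x j))\<^sup>2"]
      split[of "\<lambda>j. (cmod (x j))\<^sup>2"] rest row state
    by simp
qed

section \<open>Contractivity determines the entries\<close>

lemma truncations_contractive_entries:
  assumes disk: "\<And>i. i \<ge> 1 \<Longrightarrow> cmod (\<omega> i) < 1"
    and diag: "\<And>i. i \<ge> 1 \<Longrightarrow> M i i = \<omega> i"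
    and lower: "\<And>i j. j \<ge> 1 \<Longrightarrow> j < i \<Longrightarrow> M i j = 0"
    and superdiag: "\<And>i. i \<ge> 1 \<Longrightarrow> M i (i + 1) = defect (\<omega> i) * transfer \<omega> i (i + 1)"
    and contr: "truncations_contractive M"
    and "i \<ge> 1" "j \<ge> 1"
  shows "M i (i + j) = defect (\<omega> i) * transfer \<omega> i (i + j)"
  using \<open>i \<ge> 1\<close> \<open>j \<ge> 1\<close>
proof (induction j arbitrary: i rule: less_induct)
  case (less j)
  show ?case
  proof (cases "j = 1")
    case True
    then show ?thesis using superdiag less.prems by simp
  next
    case False
    define N where "N = i + j"
    have N: "i + 1 < N" using False less.prems by (simp add: N_def)
    \<comment> \<open>This \<open>t\<close> solves
      \<open>defect (\<omega> (i + 1)) * t + transfer \<omega> i N = 0\<close>, the condition that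
      the state \<open>s_i\<close> vanishes.\<close>
    define t where "t = - transfer \<omega> i N / defect (\<omega> (i + 1))"
    have d: "defect (\<omega> (i + 1)) \<noteq> 0"
      using defect_pos[OF disk, of "i + 1"] by simp
    define x where "x k = (if k = i + 1 then t else if k = N then 1 else 0)" for k
    have sum_x: "(\<Sum>k = a..N. f k * x k) = f (i + 1) * t + f N" if "a \<le> i + 1" for f a
    proof -
      have "(\<Sum>k = a..N. f k * x k) = (\<Sum>k \<in> {i + 1, N}. f k * x k)"
        using that N by (intro sum.mono_neutral_right) (auto simp: x_def)
      also have "\<dots> = f (i + 1) * t + f N"
        using N by (simp add: x_def)
      finally show ?thesis .
    qed
    have state: "(\<Sum>k = i + 1..N. transfer \<omega> i k * x k) = 0"
      using d by (simp only: sum_x order_refl) (simp add: transfer_Suc_same t_def)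
    \<comment> \<open>Inside the window from \<open>i + 1\<close> to \<open>N = i + j\<close>, the
      distance \<open>l - k\<close> is less than \<open>j\<close>, so the induction hypothesis
      covers every entry above the diagonal.\<close>
    have "M k l = defect (\<omega> k) * transfer \<omega> k l" if "i < k" "k < l" "l \<le> N" for k l
      using less.IH[of "l - k" k] that less.prems by (simp add: N_def)
    then have energy: "(\<Sum>k = i + 1..N. (cmod (\<Sum>l = i + 1..N. M k l * x l))\<^sup>2)
        = (\<Sum>l = i + 1..N. (cmod (x l))\<^sup>2)"
      using energy_identity[of \<omega> i N M x] state disk diag lower N by simp
    have below: "(\<Sum>l = 1..i. (cmod (x l))\<^sup>2) = 0"
      using N by (intro sum.neutral) (auto simp: x_def)
    have split: "(\<Sum>l = 1..N. f l) = (\<Sum>l = 1..i. f l) + (\<Sum>l = i + 1..N. f l)" for f :: "nat \<Rightarrow> real"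
      using N sum.ub_add_nat[of 1 i f "N - i"] by simp
    \<comment> \<open>Rows \<open>i + 1\<close> to \<open>N\<close> already use up the whole norm of
      \<open>x\<close>, so contractivity leaves nothing for rows 1 to \<open>i\<close>.\<close>
    have "(cmod (\<Sum>l = 1..N. M i l * x l))\<^sup>2 \<le> (\<Sum>k = 1..i. (cmod (\<Sum>l = 1..N. M k l * x l))\<^sup>2)"
      using less.prems by (intro member_le_sum) auto
    moreover have "(\<Sum>k = i + 1..N. (cmod (\<Sum>l = 1..N. M k l * x l))\<^sup>2)
        = (\<Sum>k = i + 1..N. (cmod (\<Sum>l = i + 1..N. M k l * x l))\<^sup>2)"
      by (simp add: sum_x)
    moreover have "(\<Sum>k = 1..N. (cmod (\<Sum>l = 1..N. M k l * x l))\<^sup>2) \<le> (\<Sum>l = 1..N. (cmod (x l))\<^sup>2)"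
      using contr unfolding truncations_contractive_def by blast
    ultimately have "(cmod (\<Sum>l = 1..N. M i l * x l))\<^sup>2 \<le> 0"
      using energy below unfolding split by linarith
    then have "M i (i + 1) * t + M i N = 0"
      by (simp add: sum_x)
    \<comment> \<open>The prescribed superdiagonal entry contains
      \<open>defect (\<omega> (i + 1))\<close>, which cancels the denominator of
      \<open>t\<close>.\<close>
    moreover have "M i (i + 1) * t = - (defect (\<omega> i) * transfer \<omega> i N)"
      using d superdiag[OF less.prems(1)] by (simp add: transfer_Suc_same t_def)
    ultimately show ?thesis
      by (simp add: N_def)
  qed
qed

theorem corollary1p2:
  fixes M :: "nat \<Rightarrow> nat \<Rightarrow> complex"
    and \<omega> :: "nat \<Rightarrow> complex"
    and \<alpha> :: "nat \<Rightarrow> nat \<Rightarrow> complex"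
  assumes diag: "\<And>i. i \<ge> 1 \<Longrightarrow> M i i = \<omega> i"
    and upper: "\<And>i j. i \<ge> 1 \<Longrightarrow> j \<ge> 1 \<Longrightarrow> M i (i + j) = \<alpha> i j"
    and lower: "\<And>i j. j \<ge> 1 \<Longrightarrow> i > j \<Longrightarrow> M i j = 0"
    and disk: "\<And>i. i \<ge> 1 \<Longrightarrow> \<omega> i \<in> ball 0 1"
    and superdiag: "\<And>i. i \<ge> 1 \<Longrightarrow>
      \<alpha> i 1 = complex_of_real (sqrt (1 - (cmod (\<omega> i))\<^sup>2) * sqrt (1 - (cmod (\<omega> (i + 1)))\<^sup>2))"
  shows "defines_contraction M \<longleftrightarrow>
    (\<forall>i\<ge>1. \<forall>j\<ge>1. \<alpha> i j =
      (\<Prod>k = i + 1..i + j - 1. - cnj (\<omega> k)) *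
        complex_of_real (sqrt (1 - (cmod (\<omega> i))\<^sup>2) * sqrt (1 - (cmod (\<omega> (i + j)))\<^sup>2)))"
proof -
  have disk': "cmod (\<omega> i) < 1" if "i \<ge> 1" for i
    using disk[OF that] by simp
  have entry: "(\<Prod>k = i + 1..i + j - 1. - cnj (\<omega> k)) *
        complex_of_real (sqrt (1 - (cmod (\<omega> i))\<^sup>2) * sqrt (1 - (cmod (\<omega> (i + j)))\<^sup>2))
      = defect (\<omega> i) * transfer \<omega> i (i + j)" if "j \<ge> 1" for i j
  proof -
    \<comment> \<open>For \<open>j = 1\<close> both ranges are empty and the product is 1.\<close>
    have "{i + 1..i + j - 1} = {i + 1..<i + j}" using that by auto
    then show ?thesis by (simp add: transfer_def defect_def)
  qed
  have "truncations_contractive M \<longleftrightarrow>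
    (\<forall>i\<ge>1. \<forall>j\<ge>1. \<alpha> i j = defect (\<omega> i) * transfer \<omega> i (i + j))"
  proof
    assume contr: "truncations_contractive M"
    have superdiag': "M i (i + 1) = defect (\<omega> i) * transfer \<omega> i (i + 1)" if "i \<ge> 1" for i
      using superdiag[OF that] upper[OF that, of 1] by (simp add: transfer_Suc_same defect_def)
    have "M i (i + j) = defect (\<omega> i) * transfer \<omega> i (i + j)" if "i \<ge> 1" "j \<ge> 1" for i j
      by (rule truncations_contractive_entries[where M = M and \<omega> = \<omega>])
        (fact disk' diag lower superdiag' contr that)+
    then show "\<forall>i\<ge>1. \<forall>j\<ge>1. \<alpha> i j = defect (\<omega> i) * transfer \<omega> i (i + j)"
      by (simp add: upper[symmetric])
  next
    assume \<alpha>: "\<forall>i\<ge>1. \<forall>j\<ge>1. \<alpha> i j = defect (\<omega> i) * transfer \<omega> i (i + j)"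
    have "M i j = defect (\<omega> i) * transfer \<omega> i j" if "i \<ge> 1" "i < j" for i j
      using upper[of i "j - i"] \<alpha> that by simp
    \<comment> \<open>With \<open>a = 0\<close> the window is the whole truncation, and the norm
      lost is exactly that of the final state \<open>s_0\<close>.\<close>
    then have energy: "(\<Sum>i = 1..N. (cmod (\<Sum>j = 1..N. M i j * x j))\<^sup>2)
        + (cmod (\<Sum>j = 1..N. transfer \<omega> 0 j * x j))\<^sup>2 = (\<Sum>j = 1..N. (cmod (x j))\<^sup>2)" for N x
      using energy_identity[of \<omega> 0 N M x] disk' diag lower by simp
    show "truncations_contractive M"
      unfolding truncations_contractive_def
    proof (intro allI)
      fix N :: nat and x :: "nat \<Rightarrow> complex"
      show "(\<Sum>i = 1..N. (cmod (\<Sum>j = 1..N. M i j * x j))\<^sup>2) \<le> (\<Sum>j = 1..N. (cmod (x j))\<^sup>2)"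
        using energy[where N = N and x = x] zero_le_power2[of "cmod (\<Sum>j = 1..N. transfer \<omega> 0 j * x j)"]
        by linarith
    qed
  qed
  then show ?thesis
    by (simp only: defines_contraction_iff_truncations entry cong: imp_cong)
qed

end
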